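(* Let $f\colon X\to\mathbb{R}$ be a filter on a Lefschetz complex, and let $(X_i,f_i)_{i\ge0}$ be the sequence of filtered Lefschetz complexes given by $X_0=X$, $f_0=f$, $X_{i+1}=X_i/\mathrm{SH}(f_i)$, $f_{i+1}=f_i|_{X_{i+1}}$. Then there exists a positive integer $m$ such that $X_m$ is boundaryless and $$\mathrm{BD}(f)=\mathrm{SH}(f_0)\sqcup\mathrm{SH}(f_1)\sqcup\dots\sqcup\mathrm{SH}(f_{m-1})$$ (a disjoint union).
   Context: Fix a field $\mathbb{F}$. A Lefschetz complex is a triple $(X,\dim,\kappa)$ with $X$ a finite set (of cells), $\dim\colon X\to\mathbb{Z}$, and an incidence map $\kappa\colon X\times X\to\mathbb{F}$ such that $\sum_{y\in X}\kappa(z,y)\kappa(y,x)=0$ for all $z,x\in X$, and $\kappa(y,x)\neq 0$ only if $\dim y=\dim x+1$. If $\kappa(y,x)\ne 0$, then $x$ is a facet of $y$ and $y$ is a cofacet of $x$. $X$ is boundaryless if $\kappa=0$. A filter on $X$ is an injective map $f\colon X\to\mathbb{R}$ with $f(x)<f(y)$ whenever $x$ is a facet of $y$; $(X,f)$ is then a filtered Lefschetz complex. Birth-death pairs: order $X$ by $f$ and let $\Delta$ be the matrix with rows and columns indexed by $X$ in this order, $\Delta[x,y]=\kappa(y,x)$. A reduced form of $\Delta$ is a matrix $R=\Delta\cdot V$ with $V-\mathrm{Id}$ strictly upper triangular and such that the pivots (lowest non-zero entries) of the non-zero columns of $R$ lie in pairwise different rows. $\mathrm{BD}(f)$ is the set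 of pairs $(s,t)\in X\times X$ such that column $t$ of $R$ is non-zero and its pivot is in row $s$; this does not depend on the choice of $R$. Shallow pairs: $\mathrm{SH}(f)$ is the set of pairs $(s,t)$ such that $s$ is a facet of $t$, $f(x)\le f(s)$ for all facets $x$ of $t$, and $f(y)\ge f(t)$ for all cofacets $y$ of $s$. Cancellation: if $s$ is a facet of $t$, the quotient of $X$ by $(s,t)$ is the Lefschetz complex with cells $X\setminus\{s,t\}$, restricted dimension map, and incidence map $\kappa'(y,x)=\kappa(y,x)-\kappa(t,s)^{-1}\kappa(y,s)\kappa(t,x)$. For $V\subseteq\mathrm{SH}(f)$, $X/V$ denotes the Lefschetz complex obtained by canceling all pairs of $V$ one after the other; this is well defined, does not depend on the order in which the pairs are canceled, and $f|_{X/V}$ is a filter on $X/V$. *)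

theory Defs
  imports Complex_Main "HOL-Library.Disjoint_Sets"
begin

section \<open>Lefschetz complexes and filters\<close>

text \<open>The dimension and incidence maps are total functions on the ambient type; only their values
  on the finite set \<open>cells X\<close> are meaningful.\<close>

record ('a, 'k) lefschetz =
  cells :: "'a set"
  cdim :: "'a \<Rightarrow> int"
  inc :: "'a \<Rightarrow> 'a \<Rightarrow> 'k"

definition lefschetz_complex :: "('a, 'k::field) lefschetz \<Rightarrow> bool" where
  "lefschetz_complex X \<longleftrightarrow>
     finite (cells X) \<and>
     (\<forall>z\<in>cells X. \<forall>x\<in>cells X. (\<Sum>y\<in>cells X. inc X z y * inc X y x) = 0) \<and>
     (\<forall>y\<in>cells X. \<forall>x\<in>cells X. inc X y x \<noteq> 0 \<longrightarrow> cdim X y = cdim X x + 1)"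

definition facet :: "('a, 'k::field) lefschetz \<Rightarrow> 'a \<Rightarrow> 'a \<Rightarrow> bool" where
  "facet X x y \<longleftrightarrow> x \<in> cells X \<and> y \<in> cells X \<and> inc X y x \<noteq> 0"

definition boundaryless :: "('a, 'k::field) lefschetz \<Rightarrow> bool" where
  "boundaryless X \<longleftrightarrow> (\<forall>y\<in>cells X. \<forall>x\<in>cells X. inc X y x = 0)"

definition lefschetz_filter :: "('a, 'k::field) lefschetz \<Rightarrow> ('a \<Rightarrow> real) \<Rightarrow> bool" where
  "lefschetz_filter X f \<longleftrightarrow> inj_on f (cells X) \<and> (\<forall>x y. facet X x y \<longrightarrow> f x < f y)"


section \<open>Birth-death pairs\<close>

text \<open>Matrices with rows and columns indexed by the cells, ordered by \<open>f\<close>, are functions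
  \<open>'a \<Rightarrow> 'a \<Rightarrow> 'k\<close> (row first) restricted to the cells. Row \<open>x\<close> is lower than row \<open>s\<close> if
  \<open>f s < f x\<close>. A column has a pivot if and only if it is non-zero.\<close>

definition bd_matrix :: "('a, 'k::field) lefschetz \<Rightarrow> 'a \<Rightarrow> 'a \<Rightarrow> 'k" where
  "bd_matrix X x y = inc X y x"

definition is_pivot ::
    "('a, 'k::field) lefschetz \<Rightarrow> ('a \<Rightarrow> real) \<Rightarrow> ('a \<Rightarrow> 'a \<Rightarrow> 'k) \<Rightarrow> 'a \<Rightarrow> 'a \<Rightarrow> bool" where
  "is_pivot X f R s t \<longleftrightarrow>
     s \<in> cells X \<and> R s t \<noteq> 0 \<and> (\<forall>x\<in>cells X. f s < f x \<longrightarrow> R x t = 0)"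

definition strictly_upper ::
    "('a, 'k::field) lefschetz \<Rightarrow> ('a \<Rightarrow> real) \<Rightarrow> ('a \<Rightarrow> 'a \<Rightarrow> 'k) \<Rightarrow> bool" where
  "strictly_upper X f U \<longleftrightarrow> (\<forall>x\<in>cells X. \<forall>y\<in>cells X. f y \<le> f x \<longrightarrow> U x y = 0)"

definition reduced_form ::
    "('a, 'k::field) lefschetz \<Rightarrow> ('a \<Rightarrow> real) \<Rightarrow> ('a \<Rightarrow> 'a \<Rightarrow> 'k) \<Rightarrow> bool" where
  "reduced_form X f R \<longleftrightarrow>
     (\<exists>V. strictly_upper X f (\<lambda>x y. V x y - (if x = y then 1 else 0)) \<and>
          (\<forall>x\<in>cells X. \<forall>t\<in>cells X. R x t = (\<Sum>y\<in>cells X. bd_matrix X x y * V y t))) \<and>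
     (\<forall>s. \<forall>t\<in>cells X. \<forall>t'\<in>cells X. is_pivot X f R s t \<and> is_pivot X f R s t' \<longrightarrow> t = t')"

definition pivot_pairs ::
    "('a, 'k::field) lefschetz \<Rightarrow> ('a \<Rightarrow> real) \<Rightarrow> ('a \<Rightarrow> 'a \<Rightarrow> 'k) \<Rightarrow> ('a \<times> 'a) set" where
  "pivot_pairs X f R = {(s, t). t \<in> cells X \<and> is_pivot X f R s t}"

text \<open>The chosen reduced form is irrelevant: see \<open>reduced_form_exists\<close> and
  \<open>BD_eq_pivot_pairs\<close> below.\<close>

definition BD :: "('a, 'k::field) lefschetz \<Rightarrow> ('a \<Rightarrow> real) \<Rightarrow> ('a \<times> 'a) set" where
  "BD X f = pivot_pairs X f (SOME R. reduced_form X f R)"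


section \<open>Shallow pairs and cancellation\<close>

definition SH :: "('a, 'k::field) lefschetz \<Rightarrow> ('a \<Rightarrow> real) \<Rightarrow> ('a \<times> 'a) set" where
  "SH X f = {(s, t). facet X s t \<and> (\<forall>x. facet X x t \<longrightarrow> f x \<le> f s) \<and>
                     (\<forall>y. facet X s y \<longrightarrow> f t \<le> f y)}"

text \<open>Incidences are set to 0 off the remaining cells, so that cancelling shallow pairs in
  different orders yields equal records.\<close>

definition cancel :: "'a \<times> 'a \<Rightarrow> ('a, 'k::field) lefschetz \<Rightarrow> ('a, 'k) lefschetz" where
  "cancel p X = (case p of (s, t) \<Rightarrow>
     \<lparr>cells = cells X - {s, t},
      cdim = cdim X,
      inc = (\<lambda>y x. if y \<in> cells X - {s, t} \<and> x \<in> cells X - {s, t}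
                   then inc X y x - inverse (inc X t s) * inc X y s * inc X t x else 0)\<rparr>)"

text \<open>The pairs of the finite set \<open>V\<close> are cancelled one after the other; for
  \<open>V \<subseteq> SH X f\<close> the order is irrelevant, see \<open>quotient_eq_fold\<close> below.\<close>

definition lefschetz_quotient :: "('a, 'k::field) lefschetz \<Rightarrow> ('a \<times> 'a) set \<Rightarrow> ('a, 'k) lefschetz" where
  "lefschetz_quotient X V = fold cancel (SOME vs. distinct vs \<and> set vs = V) X"

text \<open>The restricted filter on each complex is the same function \<open>f\<close>, of which only the values
  on the remaining cells are used.\<close>

primrec shallow_seq ::
    "('a, 'k::field) lefschetz \<Rightarrow> ('a \<Rightarrow> real) \<Rightarrow> nat \<Rightarrow> ('a, 'k) lefschetz" where
  "shallow_seq X f 0 = X"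
| "shallow_seq X f (Suc i) = lefschetz_quotient (shallow_seq X f i) (SH (shallow_seq X f i) f)"


section \<open>Quotients are well defined\<close>

lemma cancel_simps:
  "cells (cancel (s, t) X) = cells X - {s, t}"
  "cdim (cancel (s, t) X) = cdim X"
  "inc (cancel (s, t) X) y x = (if y \<in> cells X - {s, t} \<and> x \<in> cells X - {s, t}
      then inc X y x - inverse (inc X t s) * inc X y s * inc X t x else 0)"
  by (simp_all add: cancel_def)

lemma SH_I:
  assumes "facet X s t" "\<And>x. facet X x t \<Longrightarrow> f x \<le> f s" "\<And>y. facet X s y \<Longrightarrow> f t \<le> f y"
  shows "(s, t) \<in> SH X f"
  using assms by (simp add: SH_def)

lemma SH_D:
  assumes "(s, t) \<in> SH X f"
  shows "facet X s t" "\<And>x. facet X x t \<Longrightarrow> f x \<le> f s" "\<And>y. facet X s y \<Longrightarrow> f t \<le> f y"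
  using assms by (auto simp: SH_def)

lemma filter_less: "lefschetz_filter X f \<Longrightarrow> facet X x y \<Longrightarrow> f x < f y"
  by (simp add: lefschetz_filter_def)

lemma filter_eq:
  "lefschetz_filter X f \<Longrightarrow> x \<in> cells X \<Longrightarrow> y \<in> cells X \<Longrightarrow> f x = f y \<Longrightarrow> x = y"
  by (auto simp: lefschetz_filter_def dest: inj_onD)

lemma lefschetz_complex_cancel:
  assumes X: "lefschetz_complex X" and st: "facet X s t"
  shows "lefschetz_complex (cancel (s, t) X)"
proof -
  define k where "k y x = inc X y x - inverse (inc X t s) * inc X y s * inc X t x" for y x
  have st': "s \<in> cells X" "t \<in> cells X" "inc X t s \<noteq> 0"
    using st by (auto simp: facet_def)
  have fin: "finite (cells X)"
    and z: "\<And>z x. z \<in> cells X \<Longrightarrow> x \<in> cells X \<Longrightarrow> (\<Sum>y\<in>cells X. inc X z y * inc X y x) = 0"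
    and d: "\<And>y x. y \<in> cells X \<Longrightarrow> x \<in> cells X \<Longrightarrow> inc X y x \<noteq> 0 \<Longrightarrow> cdim X y = cdim X x + 1"
    using X by (auto simp: lefschetz_complex_def)
  have k0: "k y s = 0" "k t x = 0" for x y
    using st' by (auto simp: k_def)
  have sum0: "(\<Sum>y\<in>cells X - {s, t}. k u y * k y x) = 0"
    if u: "u \<in> cells X" and x: "x \<in> cells X" for u x
  proof -
    let ?c = "inverse (inc X t s)"
    have "(\<Sum>y\<in>cells X - {s, t}. k u y * k y x) = (\<Sum>y\<in>cells X. k u y * k y x)"
      by (rule sum.mono_neutral_left) (use fin k0 in auto)
    also have "\<dots> = (\<Sum>y\<in>cells X. inc X u y * inc X y x
        - (?c * inc X t x) * (inc X u y * inc X y s)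
        - (?c * inc X u s) * (inc X t y * inc X y x)
        + (?c * ?c * inc X u s * inc X t x) * (inc X t y * inc X y s))"
      by (rule sum.cong) (auto simp: k_def algebra_simps)
    also have "\<dots> = 0"
      unfolding sum.distrib sum_subtractf sum_distrib_left [symmetric]
      using z u x st' by simp
    finally show ?thesis .
  qed
  have dk: "cdim X y = cdim X x + 1" if "y \<in> cells X" "x \<in> cells X" "k y x \<noteq> 0" for x y
  proof (cases "inc X y x = 0")
    case False
    then show ?thesis using d that by blast
  next
    case True
    then have "inc X y s \<noteq> 0" "inc X t x \<noteq> 0" using that by (auto simp: k_def)
    then show ?thesis using d [of y s] d [of t x] d [of t s] that st' by simp
  qed
  have ik: "inc (cancel (s, t) X) y x = k y x"
    if "y \<in> cells X - {s, t}" "x \<in> cells X - {s, t}" for y x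
    using that by (simp add: cancel_simps k_def)
  have "(\<Sum>y\<in>cells X - {s, t}. inc (cancel (s, t) X) u y * inc (cancel (s, t) X) y x) = 0"
    if "u \<in> cells X - {s, t}" "x \<in> cells X - {s, t}" for u x
  proof -
    have "(\<Sum>y\<in>cells X - {s, t}. inc (cancel (s, t) X) u y * inc (cancel (s, t) X) y x)
        = (\<Sum>y\<in>cells X - {s, t}. k u y * k y x)"
      by (rule sum.cong) (use ik that in auto)
    then show ?thesis using sum0 [of u x] that by simp
  qed
  then show ?thesis
    unfolding lefschetz_complex_def cancel_simps(1,2)
    using fin dk ik by auto
qed

lemma facet_cancel_cases:
  assumes "facet (cancel (s, t) X) x y"
  shows "x \<in> cells X - {s, t}" "y \<in> cells X - {s, t}"
    "facet X x y \<or> (inc X y s \<noteq> 0 \<and> inc X t x \<noteq> 0)"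
  using assms by (auto simp: facet_def cancel_simps split: if_splits)

lemma lefschetz_filter_cancel:
  assumes f: "lefschetz_filter X f" and st: "(s, t) \<in> SH X f"
  shows "lefschetz_filter (cancel (s, t) X) f"
  unfolding lefschetz_filter_def
proof (intro conjI allI impI)
  show "inj_on f (cells (cancel (s, t) X))"
    using f by (auto simp: lefschetz_filter_def cancel_simps intro: inj_on_subset)
  fix x y assume a: "facet (cancel (s, t) X) x y"
  note c = facet_cancel_cases [OF a]
  have "s \<in> cells X" "t \<in> cells X" using SH_D(1) [OF st] by (auto simp: facet_def)
  from c(3) show "f x < f y"
  proof
    assume "facet X x y" then show ?thesis using f filter_less by metis
  next
    assume "inc X y s \<noteq> 0 \<and> inc X t x \<noteq> 0"
    then have "facet X s y" "facet X x t"
      using c \<open>s \<in> cells X\<close> \<open>t \<in> cells X\<close> by (auto simp: facet_def)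
    then show ?thesis
      using SH_D [OF st] filter_less [OF f SH_D(1) [OF st]] by fastforce
  qed
qed

lemma SH_disjoint:
  assumes X: "lefschetz_complex X" and f: "lefschetz_filter X f"
    and p: "(s, t) \<in> SH X f" and q: "(u, v) \<in> SH X f" and ne: "(s, t) \<noteq> (u, v)"
  shows "s \<noteq> u" "t \<noteq> v" "s \<noteq> v" "t \<noteq> u"
proof -
  note P = SH_D [OF p] and Q = SH_D [OF q]
  have cs: "s \<in> cells X" "t \<in> cells X" "u \<in> cells X" "v \<in> cells X"
    using P(1) Q(1) by (auto simp: facet_def)
  show su: "s \<noteq> u"
  proof
    assume "s = u"
    then have "f t \<le> f v" "f v \<le> f t" using P Q by auto
    then show False using filter_eq [OF f] cs ne \<open>s = u\<close> by auto
  qed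
  show "t \<noteq> v"
  proof
    assume "t = v"
    then have "f s \<le> f u" "f u \<le> f s" using P Q by auto
    then show False using filter_eq [OF f] cs su by auto
  qed
  have chain: False if "(a, b) \<in> SH X f" "(b, c) \<in> SH X f" for a b c
  proof -
    note A = SH_D [OF that(1)] and B = SH_D [OF that(2)]
    have c: "a \<in> cells X" "b \<in> cells X" "c \<in> cells X" using A(1) B(1) by (auto simp: facet_def)
    have "(\<Sum>y\<in>cells X. inc X c y * inc X y a) = 0" "finite (cells X)"
      using X c by (auto simp: lefschetz_complex_def)
    moreover have "(\<Sum>y\<in>cells X. inc X c y * inc X y a) = inc X c b * inc X b a
        + (\<Sum>y\<in>cells X - {b}. inc X c y * inc X y a)"
      using c \<open>finite (cells X)\<close> by (intro sum.remove) auto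
    moreover have "inc X c y * inc X y a = 0" if "y \<in> cells X - {b}" for y
    proof (rule ccontr)
      assume "inc X c y * inc X y a \<noteq> 0"
      then have "facet X y c" "facet X a y" using c that by (auto simp: facet_def)
      then have "f y \<le> f b" "f b \<le> f y" using A B by auto
      then show False using filter_eq [OF f] c that by auto
    qed
    ultimately have "inc X c b * inc X b a = 0" by simp
    then show False using A(1) B(1) by (auto simp: facet_def)
  qed
  show "s \<noteq> v" using chain p q by blast
  show "t \<noteq> u" using chain p q by blast
qed

lemma SH_cross:
  assumes f: "lefschetz_filter X f"
    and p: "(s, t) \<in> SH X f" and q: "(u, v) \<in> SH X f" and ne: "t \<noteq> v"
  shows "inc X v s = 0 \<or> inc X t u = 0"
proof (rule ccontr)
  assume "\<not> ?thesis"
  then have "facet X s v" "facet X u t"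
    using SH_D(1) [OF p] SH_D(1) [OF q] by (auto simp: facet_def)
  then have "f t \<le> f v" "f v \<le> f t" using SH_D(3) [OF p] SH_D(3) [OF q] by auto
  then show False
    using filter_eq [OF f] ne SH_D(1) [OF p] SH_D(1) [OF q] by (auto simp: facet_def)
qed

lemma SH_cancel:
  assumes X: "lefschetz_complex X" and f: "lefschetz_filter X f"
    and p: "(s, t) \<in> SH X f" and q: "(u, v) \<in> SH X f" and ne: "(s, t) \<noteq> (u, v)"
  shows "(u, v) \<in> SH (cancel (s, t) X) f"
proof (rule SH_I)
  note P = SH_D [OF p] and Q = SH_D [OF q] and D = SH_disjoint [OF X f p q ne]
  have cs: "s \<in> cells X" "t \<in> cells X" "u \<in> cells X" "v \<in> cells X"
    using P(1) Q(1) by (auto simp: facet_def)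
  show "facet (cancel (s, t) X) u v"
    using SH_cross [OF f p q D(2)] D cs Q(1) by (auto simp: facet_def cancel_simps)
  show "f x \<le> f u" if "facet (cancel (s, t) X) x v" for x
  proof (cases "facet X x v")
    case False
    then have "facet X s v" "facet X x t"
      using facet_cancel_cases [OF that] cs by (auto simp: facet_def)
    then show ?thesis using P Q by fastforce
  qed (use Q in auto)
  show "f v \<le> f y" if "facet (cancel (s, t) X) u y" for y
  proof (cases "facet X u y")
    case False
    then have "facet X s y" "facet X u t"
      using facet_cancel_cases [OF that] cs by (auto simp: facet_def)
    then show ?thesis using P Q by fastforce
  qed (use Q in auto)
qed

lemma cancel_commute:
  assumes X: "lefschetz_complex X" and f: "lefschetz_filter X f"
    and p: "p \<in> SH X f" and q: "q \<in> SH X f"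
  shows "cancel p (cancel q X) = cancel q (cancel p X)"
proof (cases "p = q")
  case False
  obtain s t u v where pq: "p = (s, t)" "q = (u, v)" by (metis surj_pair)
  have p': "(s, t) \<in> SH X f" and q': "(u, v) \<in> SH X f" and ne: "(s, t) \<noteq> (u, v)"
    using p q False pq by auto
  note D = SH_disjoint [OF X f p' q' ne] and C = SH_cross [OF f p' q' D(2)]
  have nz: "inc X t s \<noteq> 0" "inc X v u \<noteq> 0"
    and cs: "s \<in> cells X" "t \<in> cells X" "u \<in> cells X" "v \<in> cells X"
    using SH_D(1) [OF p'] SH_D(1) [OF q'] by (auto simp: facet_def)
  have "inc (cancel p (cancel q X)) y x = inc (cancel q (cancel p X)) y x" for y x
    using C D nz cs unfolding pq cancel_simps by (auto simp: algebra_simps)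
  moreover have "cells (cancel p (cancel q X)) = cells (cancel q (cancel p X))"
    "cdim (cancel p (cancel q X)) = cdim (cancel q (cancel p X))"
    unfolding pq cancel_simps by auto
  ultimately show ?thesis by (intro lefschetz.equality) (auto intro!: ext)
qed simp

lemma cancel_SH:
  assumes X: "lefschetz_complex X" and f: "lefschetz_filter X f" and p: "p \<in> SH X f"
  shows "lefschetz_complex (cancel p X)" "lefschetz_filter (cancel p X) f"
    "\<And>q. q \<in> SH X f \<Longrightarrow> q \<noteq> p \<Longrightarrow> q \<in> SH (cancel p X) f"
proof -
  obtain s t where st: "p = (s, t)" by (cases p)
  show "lefschetz_complex (cancel p X)" "lefschetz_filter (cancel p X) f"
    using lefschetz_complex_cancel [OF X SH_D(1)] lefschetz_filter_cancel [OF f] p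
    unfolding st by auto
  show "q \<in> SH (cancel p X) f" if "q \<in> SH X f" "q \<noteq> p" for q
  proof -
    obtain u v where uv: "q = (u, v)" by (cases q)
    show ?thesis
      unfolding st uv by (rule SH_cancel [OF X f]) (use p st uv that in auto)
  qed
qed

lemma fold_cancel_filtered:
  assumes "lefschetz_complex X" "lefschetz_filter X f" "set vs \<subseteq> SH X f" "distinct vs"
  shows "lefschetz_complex (fold cancel vs X) \<and> lefschetz_filter (fold cancel vs X) f"
  using assms
proof (induction vs arbitrary: X)
  case (Cons p vs)
  have *: "lefschetz_complex (cancel p X)" "lefschetz_filter (cancel p X) f"
    "set vs \<subseteq> SH (cancel p X) f"
    using cancel_SH [of X f p] Cons.prems by auto
  then show ?case using Cons.IH [OF *] Cons.prems by simp
qed auto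

lemma fold_cancel_front:
  assumes "lefschetz_complex X" "lefschetz_filter X f" "distinct (vs @ p # ws)"
    "set (vs @ p # ws) \<subseteq> SH X f"
  shows "fold cancel (vs @ p # ws) X = fold cancel (vs @ ws) (cancel p X)"
  using assms
proof (induction vs arbitrary: X)
  case (Cons q vs)
  have q: "q \<in> SH X f" using Cons.prems by simp
  note C = cancel_SH [OF Cons.prems(1,2) q]
  have "r \<in> SH (cancel q X) f" if "r \<in> set (vs @ p # ws)" for r
    by (rule C(3)) (use Cons.prems that in auto)
  then have "set (vs @ p # ws) \<subseteq> SH (cancel q X) f" by blast
  with C(1,2) have "fold cancel (vs @ p # ws) (cancel q X)
      = fold cancel (vs @ ws) (cancel p (cancel q X))"
    by (intro Cons.IH) (use Cons.prems in auto)
  moreover have "cancel p (cancel q X) = cancel q (cancel p X)"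
    by (rule cancel_commute [of X f]) (use Cons.prems in auto)
  ultimately show ?case by simp
qed simp

lemma fold_cancel_order:
  assumes "lefschetz_complex X" "lefschetz_filter X f" "set vs \<subseteq> SH X f"
    "distinct vs" "distinct ws" "set ws = set vs"
  shows "fold cancel vs X = fold cancel ws X"
  using assms
proof (induction vs arbitrary: X ws)
  case (Cons p vs)
  obtain ws1 ws2 where ws: "ws = ws1 @ p # ws2"
    using Cons.prems by (metis list.set_intros(1) split_list)
  have "fold cancel ws X = fold cancel (ws1 @ ws2) (cancel p X)"
    unfolding ws by (rule fold_cancel_front [of X f]) (use Cons.prems ws in simp_all)
  also have "\<dots> = fold cancel vs (cancel p X)"
  proof (rule Cons.IH [symmetric])
    show "lefschetz_complex (cancel p X)" "lefschetz_filter (cancel p X) f"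
      "set vs \<subseteq> SH (cancel p X) f"
      using cancel_SH [of X f p] Cons.prems by auto
    show "distinct vs" "distinct (ws1 @ ws2)" using Cons.prems ws by auto
    have "set (ws1 @ ws2) = set ws - {p}" using Cons.prems(5) ws by auto
    then show "set (ws1 @ ws2) = set vs" using Cons.prems(4,6) by simp
  qed
  finally show ?case by simp
qed simp

theorem quotient_eq_fold:
  assumes "lefschetz_complex X" "lefschetz_filter X f" "set vs \<subseteq> SH X f" "distinct vs"
  shows "lefschetz_quotient X (set vs) = fold cancel vs X"
proof -
  have "\<exists>ws. distinct ws \<and> set ws = set vs" using assms by blast
  then have "distinct (SOME ws. distinct ws \<and> set ws = set vs) \<and>
      set (SOME ws. distinct ws \<and> set ws = set vs) = set vs"
    by (rule someI_ex)
  then show ?thesis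
    unfolding lefschetz_quotient_def by (intro fold_cancel_order [OF assms, symmetric]) simp_all
qed

theorem quotient_filtered:
  assumes X: "lefschetz_complex X" and f: "lefschetz_filter X f" and V: "V \<subseteq> SH X f"
  shows "lefschetz_complex (lefschetz_quotient X V)" "lefschetz_filter (lefschetz_quotient X V) f"
proof -
  have "SH X f \<subseteq> cells X \<times> cells X" by (auto simp: SH_def facet_def)
  then have "finite V"
    using X V by (meson finite_SigmaI finite_subset lefschetz_complex_def)
  then obtain vs where vs: "set vs = V" "distinct vs"
    using finite_distinct_list by blast
  show "lefschetz_complex (lefschetz_quotient X V)" "lefschetz_filter (lefschetz_quotient X V) f"
    using fold_cancel_filtered [OF X f, of vs] quotient_eq_fold [OF X f, of vs] vs V by auto
qed


section \<open>Birth-death pairs are well defined\<close>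

context
  fixes X :: "('a, 'k::field) lefschetz" and f :: "'a \<Rightarrow> real"
  assumes fin: "finite (cells X)" and inj: "inj_on f (cells X)"
begin

definition low :: "('a \<Rightarrow> 'k) \<Rightarrow> 'a set" where
  "low c = {x \<in> cells X. \<exists>y\<in>cells X. f x \<le> f y \<and> c y \<noteq> 0}"

lemma ex_max:
  assumes "finite A" "A \<noteq> {}"
  shows "\<exists>r\<in>A. \<forall>y\<in>A. f y \<le> f r"
proof -
  have "Max (f ` A) \<in> f ` A" using assms by (intro Max_in) auto
  then obtain r where r: "r \<in> A" "f r = Max (f ` A)" by auto
  have "f y \<le> f r" if "y \<in> A" for y using r that assms by simp
  then show ?thesis using r by blast
qed

lemma ex_pivot:
  assumes "t \<in> cells X" "x \<in> cells X" "R x t \<noteq> 0"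
  shows "\<exists>s. is_pivot X f R s t \<and> f x \<le> f s"
proof -
  let ?A = "{x \<in> cells X. R x t \<noteq> 0}"
  have A: "finite ?A" "x \<in> ?A" using fin assms by auto
  have "\<exists>s\<in>?A. \<forall>y\<in>?A. f y \<le> f s"
    by (rule ex_max) (use A in auto)
  then obtain s where "s \<in> ?A" "\<forall>y\<in>?A. f y \<le> f s" by blast
  then show ?thesis using A(2) by (auto simp: is_pivot_def intro!: exI [of _ s])
qed

theorem reduced_form_exists: "\<exists>R. reduced_form X f R"
proof -
  define col where "col v x = (\<Sum>y\<in>cells X. bd_matrix X x y * v y)" for v :: "'a \<Rightarrow> 'k" and x
  define adm where "adm t v \<longleftrightarrow> v t = 1 \<and> (\<forall>x\<in>cells X. f t \<le> f x \<longrightarrow> x \<noteq> t \<longrightarrow> v x = 0)"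
    for t and v :: "'a \<Rightarrow> 'k"
  have "\<exists>v. adm t v \<and> (\<forall>w. adm t w \<longrightarrow> card (low (col v)) \<le> card (low (col w)))" for t
    by (rule ex_has_least_nat [of _ "\<lambda>x. if x = t then 1 else 0"]) (auto simp: adm_def)
  then obtain W where W: "\<And>t. adm t (W t)"
    "\<And>t w. adm t w \<Longrightarrow> card (low (col (W t))) \<le> card (low (col w))"
    by metis
  define R where "R x t = col (W t) x" for x t
  have distinct_pivots: False
    if t: "t \<in> cells X" "u \<in> cells X" "f u < f t" "is_pivot X f R s t" "is_pivot X f R s u" for s t u
  proof -
    define l where "l = R s t / R s u"
    define w where "w x = W t x - l * W u x" for x
    have "adm t w"
      using W(1) [of t] W(1) [of u] t by (auto simp: adm_def w_def)
    have cw: "col w x = R x t - l * R x u" for x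
      by (simp add: col_def w_def R_def sum_subtractf sum_distrib_left algebra_simps)
    have s: "s \<in> cells X" "R s t \<noteq> 0" "R s u \<noteq> 0"
      "\<And>x. x \<in> cells X \<Longrightarrow> f s < f x \<Longrightarrow> R x t = 0 \<and> R x u = 0"
      using t by (auto simp: is_pivot_def)
    have c0: "col w x = 0" if "x \<in> cells X" "f s \<le> f x" for x
    proof (cases "x = s")
      case True then show ?thesis using s by (simp add: cw l_def)
    next
      case False
      then have "f s < f x" using that s inj by (metis inj_onD order_le_less)
      then show ?thesis using s that by (simp add: cw)
    qed
    have "low (col w) \<subset> low (col (W t))"
    proof
      have "f x \<le> f s" if "x \<in> low (col w)" for x
        using that c0 unfolding low_def by fastforce
      then show "low (col w) \<subseteq> low (col (W t))"
        using s by (auto simp: low_def R_def)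
      have "s \<in> low (col (W t))" using s by (auto simp: low_def R_def)
      moreover have "s \<notin> low (col w)" using c0 by (auto simp: low_def)
      ultimately show "low (col w) \<noteq> low (col (W t))" by blast
    qed
    moreover have "finite (low (col (W t)))" using fin by (simp add: low_def)
    ultimately have "card (low (col w)) < card (low (col (W t)))" by (simp add: psubset_card_mono)
    then show False using W(2) [OF \<open>adm t w\<close>] by simp
  qed
  have "reduced_form X f R"
    unfolding reduced_form_def
  proof (intro conjI exI [of _ "\<lambda>y t. W t y"] ballI allI impI)
    show "strictly_upper X f (\<lambda>x y. W y x - (if x = y then 1 else 0))"
      using W(1) by (auto simp: strictly_upper_def adm_def)
    show "R x t = (\<Sum>y\<in>cells X. bd_matrix X x y * W t y)" for x t
      by (simp add: R_def col_def)
    fix s t u assume "t \<in> cells X" "u \<in> cells X" "is_pivot X f R s t \<and> is_pivot X f R s u"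
    then show "t = u"
      using distinct_pivots [of t u s] distinct_pivots [of u t s] inj
      by (metis inj_onD linorder_neqE_linordered_idom)
  qed
  then show ?thesis by blast
qed

lemma column_combination:
  assumes V: "strictly_upper X f (\<lambda>x y. V x y - (if x = y then 1 else 0))"
    and R: "\<forall>x\<in>cells X. \<forall>t\<in>cells X. R x t = (\<Sum>y\<in>cells X. bd_matrix X x y * V y t)"
    and t: "t \<in> cells X" and v: "\<forall>x\<in>cells X. f t < f x \<longrightarrow> v x = 0"
  shows "\<exists>w. w t = v t \<and> (\<forall>x\<in>cells X. f t < f x \<longrightarrow> w x = 0) \<and>
    (\<forall>x\<in>cells X. (\<Sum>y\<in>cells X. bd_matrix X x y * v y) = (\<Sum>u\<in>cells X. R x u * w u))"
  using t v
proof (induction "card {u \<in> cells X. f u < f t}" arbitrary: t v rule: less_induct)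
  case less
  define v' where "v' y = v y - v t * V y t" for y
  have V1: "V t t = 1" using V less.prems by (auto simp: strictly_upper_def)
  have V0: "V x t = 0" if "x \<in> cells X" "f t < f x" for x
    using V less.prems that by (auto simp: strictly_upper_def split: if_splits)
  have v'0: "v' x = 0" if "x \<in> cells X" "f t \<le> f x" for x
  proof (cases "x = t")
    case True then show ?thesis by (simp add: v'_def V1)
  next
    case False
    then have "f t < f x" using that less.prems inj by (metis inj_onD order_le_less)
    then show ?thesis using V0 that less.prems by (simp add: v'_def)
  qed
  have split: "(\<Sum>y\<in>cells X. bd_matrix X x y * v y)
      = v t * R x t + (\<Sum>y\<in>cells X. bd_matrix X x y * v' y)" if "x \<in> cells X" for x
    using that R less.prems
    by (simp add: v'_def sum_subtractf sum_distrib_left algebra_simps)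
  have "\<exists>w. (\<forall>x\<in>cells X. f t \<le> f x \<longrightarrow> w x = 0) \<and>
    (\<forall>x\<in>cells X. (\<Sum>y\<in>cells X. bd_matrix X x y * v' y) = (\<Sum>u\<in>cells X. R x u * w u))"
  proof (cases "{u \<in> cells X. f u < f t} = {}")
    case True
    then have "v' x = 0" if "x \<in> cells X" for x using v'0 [OF that] that by force
    then show ?thesis by (intro exI [of _ "\<lambda>_. 0"]) simp
  next
    case False
    let ?A = "{u \<in> cells X. f u < f t}"
    have "finite ?A" using fin by simp
    then have "\<exists>t'\<in>?A. \<forall>y\<in>?A. f y \<le> f t'"
      using False by (rule ex_max)
    then obtain t' where t': "t' \<in> cells X" "f t' < f t" "\<forall>y\<in>?A. f y \<le> f t'" by blast
    have "{u \<in> cells X. f u < f t'} \<subset> ?A" using t' by force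
    then have "card {u \<in> cells X. f u < f t'} < card ?A"
      using fin by (intro psubset_card_mono) auto
    moreover have gt: "f t \<le> f x" if "x \<in> cells X" "f t' < f x" for x
      using t' that by force
    then have "\<forall>x\<in>cells X. f t' < f x \<longrightarrow> v' x = 0" using v'0 by blast
    ultimately obtain w where "\<forall>x\<in>cells X. f t' < f x \<longrightarrow> w x = 0"
      "\<forall>x\<in>cells X. (\<Sum>y\<in>cells X. bd_matrix X x y * v' y) = (\<Sum>u\<in>cells X. R x u * w u)"
      using less.hyps [of t' v'] t' by blast
    then show ?thesis using t' by (intro exI [of _ w]) auto
  qed
  then obtain w where w: "\<And>x. x \<in> cells X \<Longrightarrow> f t \<le> f x \<Longrightarrow> w x = 0"
    "\<And>x. x \<in> cells X \<Longrightarrow> (\<Sum>y\<in>cells X. bd_matrix X x y * v' y) = (\<Sum>u\<in>cells X. R x u * w u)"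
    by blast
  have wt: "w t = 0" using w(1) less.prems by simp
  have "(\<Sum>u\<in>cells X. R x u * (w(t := v t)) u) = v t * R x t + (\<Sum>u\<in>cells X. R x u * w u)" for x
  proof -
    have "(\<Sum>u\<in>cells X. R x u * (w(t := v t)) u)
        = R x t * v t + (\<Sum>u\<in>cells X - {t}. R x u * (w(t := v t)) u)"
      using sum.remove [OF fin less.prems(1), of "\<lambda>u. R x u * (w(t := v t)) u"] by simp
    also have "(\<Sum>u\<in>cells X - {t}. R x u * (w(t := v t)) u) = (\<Sum>u\<in>cells X - {t}. R x u * w u)"
      by (rule sum.cong) auto
    also have "\<dots> = (\<Sum>u\<in>cells X. R x u * w u)"
      using sum.remove [OF fin less.prems(1), of "\<lambda>u. R x u * w u"] wt by simp
    finally show ?thesis by (simp add: mult.commute)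
  qed
  then show ?case
    using w split by (intro exI [of _ "w(t := v t)"]) auto
qed

lemma pivot_le:
  assumes R: "reduced_form X f R" and R': "reduced_form X f R'"
    and t: "t \<in> cells X" and s: "is_pivot X f R s t"
  shows "\<exists>s'. is_pivot X f R' s' t \<and> f s \<le> f s'"
proof -
  obtain V where V: "strictly_upper X f (\<lambda>x y. V x y - (if x = y then 1 else 0))"
    "\<forall>x\<in>cells X. \<forall>t\<in>cells X. R x t = (\<Sum>y\<in>cells X. bd_matrix X x y * V y t)"
    using R by (auto simp: reduced_form_def)
  obtain V' where V': "strictly_upper X f (\<lambda>x y. V' x y - (if x = y then 1 else 0))"
    "\<forall>x\<in>cells X. \<forall>t\<in>cells X. R' x t = (\<Sum>y\<in>cells X. bd_matrix X x y * V' y t)"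
    using R' by (auto simp: reduced_form_def)
  have uniq: "a = b" if "a \<in> cells X" "b \<in> cells X" "is_pivot X f R r a" "is_pivot X f R r b" for r a b
    using R that by (auto simp: reduced_form_def)
  have "\<forall>x\<in>cells X. f t < f x \<longrightarrow> V' x t = 0"
    using V'(1) t by (auto simp: strictly_upper_def split: if_splits)
  moreover have Vt: "V' t t = 1" using V'(1) t by (auto simp: strictly_upper_def)
  ultimately obtain w where w: "w t = 1"
    "\<forall>x\<in>cells X. (\<Sum>y\<in>cells X. bd_matrix X x y * V' y t) = (\<Sum>u\<in>cells X. R x u * w u)"
    using column_combination [OF V t, of "\<lambda>y. V' y t"] by auto
  let ?A = "{r \<in> cells X. \<exists>u\<in>cells X. w u \<noteq> 0 \<and> is_pivot X f R r u}"
  have A: "finite ?A" "s \<in> ?A" using fin t s w by (auto simp: is_pivot_def intro!: bexI [of _ t])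
  have "\<exists>r\<in>?A. \<forall>y\<in>?A. f y \<le> f r"
    by (rule ex_max) (use A in blast)+
  then obtain r where r: "r \<in> ?A" "\<forall>y\<in>?A. f y \<le> f r" by blast
  then obtain u where u: "u \<in> cells X" "w u \<noteq> 0" "is_pivot X f R r u" by blast
  have rX: "r \<in> cells X" "R r u \<noteq> 0" using u by (auto simp: is_pivot_def)
  have z: "R r a * w a = 0" if a: "a \<in> cells X" "a \<noteq> u" for a
  proof (rule ccontr)
    assume n: "R r a * w a \<noteq> 0"
    then obtain q where q: "is_pivot X f R q a" "f r \<le> f q"
      using ex_pivot [of a r R] a rX by auto
    have "q \<in> ?A" using q a n by (auto simp: is_pivot_def)
    then have "f q = f r" using q(2) r(2) by force
    then have "q = r" using q(1) rX inj by (auto simp: is_pivot_def dest: inj_onD)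
    then show False using uniq u q a by blast
  qed
  have "R' r t = (\<Sum>a\<in>cells X. R r a * w a)" using V'(2) w(2) rX t by simp
  also have "\<dots> = R r u * w u"
    using sum.remove [OF fin u(1), of "\<lambda>a. R r a * w a"] z by simp
  finally have "R' r t \<noteq> 0" using rX u by simp
  then obtain s' where "is_pivot X f R' s' t" "f r \<le> f s'" using ex_pivot t rX by blast
  moreover have "f s \<le> f r" using r A by blast
  ultimately show ?thesis by force
qed

lemma is_pivot_unique:
  assumes "is_pivot X f R s t" "is_pivot X f R s' t" shows "s = s'"
  using assms inj unfolding is_pivot_def by (metis inj_onD linorder_neqE_linordered_idom)

lemma pivot_pairs_subset:
  assumes R: "reduced_form X f R" and R': "reduced_form X f R'"
  shows "pivot_pairs X f R \<subseteq> pivot_pairs X f R'"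
proof (clarsimp simp: pivot_pairs_def)
  fix s t assume t: "t \<in> cells X" and s: "is_pivot X f R s t"
  obtain s' where s': "is_pivot X f R' s' t" "f s \<le> f s'" using pivot_le [OF R R' t s] by blast
  obtain s'' where s'': "is_pivot X f R s'' t" "f s' \<le> f s''" using pivot_le [OF R' R t s'(1)] by blast
  have "s'' = s" using is_pivot_unique s s'' by blast
  then have "f s = f s'" using s' s'' by simp
  then have "s = s'" using s s' inj by (auto simp: is_pivot_def dest: inj_onD)
  then show "is_pivot X f R' s t" using s' by simp
qed

theorem BD_eq_pivot_pairs:
  assumes "reduced_form X f R"
  shows "BD X f = pivot_pairs X f R"
  unfolding BD_def
  using pivot_pairs_subset someI_ex [OF reduced_form_exists] assms by blast

end

end

theory Submission
  imports Defs
begin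

text \<open>The statement is an induction over one fact: cancelling a shallow pair \<open>(s, t)\<close> removes exactly
  that pair from the birth-death pairs (\<open>BD_cancel\<close>).

  To see this, lift a reduced form of the quotient to \<open>X\<close>. Write \<open>\<partial>\<close> for the boundary, so that the
  columns of the boundary matrix are the chains \<open>\<partial>u\<close>. Shallowness says first that \<open>s\<close> is
  the last facet of \<open>t\<close>, so the unmodified column \<open>\<partial>t\<close> already has its pivot in row \<open>s\<close>, and
  \<open>\<partial>\<partial>t = 0\<close> expresses \<open>\<partial>s\<close> by earlier columns, so column \<open>s\<close> can be reduced to zero. It says
  secondly that \<open>t\<close> is the first cofacet of \<open>s\<close>, so row \<open>s\<close> can be cleared from every other column
  \<open>u\<close> by adding multiples of the earlier column \<open>t\<close>. On the cells other than \<open>s\<close> and \<open>t\<close> the cleared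
  matrix is the boundary matrix of the quotient, whose column operations can be
  applied to it. The only entries not controlled by the quotient are those in row \<open>t\<close>. They never become
  pivots: a cycle without \<open>s\<close>-coordinate cannot end in \<open>t\<close>, because the
  contribution of \<open>t\<close> to the coefficient of \<open>s\<close> in its boundary can be cancelled only by
  another cofacet of \<open>s\<close>, all of which come after \<open>t\<close>.

  The sequence of quotients reaches a boundaryless complex since a pair of a cell and a facet of
  it whose filter values are as close as possible is shallow (\<open>SH_nonempty\<close>). There the boundary
  matrix vanishes, so no birth-death pairs are left. Disjointness holds because the cells of
  the pairs in one step are absent from all later complexes.\<close>

section \<open>Cancelling one shallow pair\<close>

lemma BD_eq_empty_if_boundaryless:
  assumes X: "lefschetz_complex X" and f: "lefschetz_filter X f" and b: "boundaryless X"
  shows "BD X f = {}"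
proof -
  have fi: "finite (cells X)" "inj_on f (cells X)"
    using X f by (auto simp: lefschetz_complex_def lefschetz_filter_def)
  obtain R where R: "reduced_form X f R" using reduced_form_exists [OF fi] by blast
  then have "R x t = 0" if "x \<in> cells X" "t \<in> cells X" for x t
    using b that by (auto simp: reduced_form_def boundaryless_def bd_matrix_def)
  then have "pivot_pairs X f R = {}" by (auto simp: pivot_pairs_def is_pivot_def)
  then show ?thesis using BD_eq_pivot_pairs [OF fi R] by simp
qed

text \<open>The columns of the reduced form of \<open>X\<close> built here are \<open>0\<close> for \<open>s\<close>, \<open>\<partial>t\<close> for \<open>t\<close>, and for every
  other \<open>u\<close> the column of \<open>u\<close> in a reduced form of the quotient, extended by \<open>0\<close> in row \<open>s\<close> and by some
  entry in row \<open>t\<close> that is not a pivot.\<close>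

lemma BD_cancel:
  assumes X: "lefschetz_complex X" and f: "lefschetz_filter X f" and p: "(s, t) \<in> SH X f"
  shows "BD X f = insert (s, t) (BD (cancel (s, t) X) f)"
proof -
  define Y where "Y = cancel (s, t) X"
  define C where "C = cells X - {s, t}"
  define c where "c = inverse (inc X t s)"
  note P = SH_D [OF p]
  have st: "s \<in> cells X" "t \<in> cells X" "inc X t s \<noteq> 0" "f s < f t"
    using P(1) filter_less [OF f P(1)] by (auto simp: facet_def)
  then have "s \<noteq> t" by auto
  have cY: "cells Y = C" by (simp add: Y_def C_def cancel_simps)
  have iY: "inc Y y x = inc X y x - c * inc X y s * inc X t x" if "y \<in> C" "x \<in> C" for y x
    using that by (simp add: Y_def C_def c_def cancel_simps)
  have LY: "lefschetz_complex Y" "lefschetz_filter Y f"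
    using lefschetz_complex_cancel [OF X P(1)] lefschetz_filter_cancel [OF f p] by (simp_all add: Y_def)
  have fi: "finite (cells X)" "inj_on f (cells X)" "finite (cells Y)" "inj_on f (cells Y)"
    using X f LY by (auto simp: lefschetz_complex_def lefschetz_filter_def)
  have dd: "(\<Sum>y\<in>cells X. inc X z y * inc X y x) = 0" if "z \<in> cells X" "x \<in> cells X" for z x
    using X that by (auto simp: lefschetz_complex_def)
  have X_C: "cells X = insert s (insert t C)" "s \<notin> C" "t \<notin> C" "finite C" "C \<subseteq> cells X"
    using st fi by (auto simp: C_def)
  have sumX: "(\<Sum>y\<in>cells X. g y) = g s + (g t + (\<Sum>y\<in>C. g y))" for g :: "'a \<Rightarrow> 'b"
    using X_C \<open>s \<noteq> t\<close> by simp
  have last_facet: "inc X t x = 0" if "x \<in> cells X" "f s \<le> f x" "x \<noteq> s" for x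
    using P(2) [of x] filter_eq [OF f that(1) st(1)] that st by (force simp: facet_def)
  have first_cofacet: "f t < f y" if "y \<in> C" "inc X y s \<noteq> 0" for y
    using P(3) [of y] filter_eq [OF f, of y t] that st by (force simp: facet_def C_def)

  obtain R' where R': "reduced_form Y f R'" using reduced_form_exists [OF fi(3,4)] by blast
  then obtain V' where V': "strictly_upper Y f (\<lambda>x y. V' x y - (if x = y then 1 else 0))"
    and R'V': "\<And>x u. x \<in> C \<Longrightarrow> u \<in> C \<Longrightarrow> R' x u = (\<Sum>y\<in>C. inc Y y x * V' y u)"
    by (auto simp: reduced_form_def bd_matrix_def cY)
  \<comment> \<open>Column \<open>s\<close> is the multiple of \<open>\<partial>t\<close> in which \<open>s\<close> has coefficient \<open>1\<close>, hence a cycle. In the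
    columns of \<open>C\<close>, the entry in row \<open>t\<close> is the multiple of \<open>\<partial>t\<close> that clears row \<open>s\<close>.\<close>
  define V where "V y u = (if u = s then c * inc X t y
      else if u = t then (if y = t then 1 else 0)
      else if y = s then 0
      else if y = t then - c * (\<Sum>z\<in>C. inc X z s * V' z u)
      else V' y u)" for y u
  define R where "R x u = (\<Sum>y\<in>cells X. inc X y x * V y u)" for x u

  have Rs: "R x s = 0" if "x \<in> cells X" for x
  proof -
    have "R x s = c * (\<Sum>y\<in>cells X. inc X t y * inc X y x)"
      by (simp add: R_def V_def sum_distrib_left algebra_simps)
    then show ?thesis using dd that st by simp
  qed
  have Rt: "R x t = inc X t x" for x
  proof -
    have "(\<Sum>y\<in>C. inc X y x * V y t) = 0"
      using X_C \<open>s \<noteq> t\<close> by (intro sum.neutral) (auto simp: V_def)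
    then show ?thesis using \<open>s \<noteq> t\<close> by (simp add: R_def sumX V_def)
  qed
  have Ru: "R x u = (\<Sum>y\<in>C. (inc X y x - c * inc X y s * inc X t x) * V' y u)"
    if "u \<in> C" for x u
  proof -
    have ne: "u \<noteq> s" "u \<noteq> t" using that X_C by auto
    have "(\<Sum>y\<in>C. inc X y x * V y u) = (\<Sum>y\<in>C. inc X y x * V' y u)"
      using X_C ne by (intro sum.cong) (auto simp: V_def)
    then have "R x u = (\<Sum>y\<in>C. inc X y x * V' y u)
        - inc X t x * (c * (\<Sum>z\<in>C. inc X z s * V' z u))"
      using ne \<open>s \<noteq> t\<close> by (simp add: R_def sumX V_def)
    then show ?thesis
      by (simp add: sum_distrib_left sum_subtractf algebra_simps)
  qed
  have RC: "R x u = R' x u" if "x \<in> C" "u \<in> C" for x u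
    using that by (simp add: Ru R'V' iY)
  have Rsu: "R s u = 0" if "u \<in> C" for u
    using that st by (simp add: Ru c_def mult.commute [of "inverse (inc X t s)"] mult.assoc)
  have cycle: "(\<Sum>x\<in>cells X. R x u * inc X x z) = 0" if "z \<in> cells X" for u z
  proof -
    have "(\<Sum>x\<in>cells X. R x u * inc X x z)
        = (\<Sum>x\<in>cells X. \<Sum>y\<in>cells X. V y u * (inc X y x * inc X x z))"
      unfolding R_def sum_distrib_right by (simp add: mult_ac)
    also have "\<dots> = (\<Sum>y\<in>cells X. V y u * (\<Sum>x\<in>cells X. inc X y x * inc X x z))"
      by (subst sum.swap) (simp add: sum_distrib_left)
    also have "\<dots> = 0" using dd that by simp
    finally show ?thesis .
  qed
  have row_t: "\<exists>x\<in>C. f t < f x \<and> R' x u \<noteq> 0" if u: "u \<in> C" and n: "R t u \<noteq> 0" for u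
  proof (rule ccontr)
    assume a: "\<not> ?thesis"
    have "R x u * inc X x s = 0" if "x \<in> C" for x
      using a first_cofacet [of x] RC that u by (cases "inc X x s = 0") auto
    then have "(\<Sum>x\<in>C. R x u * inc X x s) = 0" by (rule sum.neutral [OF ballI])
    then have "R t u * inc X t s = 0"
      using cycle [of s u] st Rsu [OF u] by (simp add: sumX)
    then show False using n st by simp
  qed

  have pivot_u: "is_pivot X f R r u \<longleftrightarrow> is_pivot Y f R' r u" if u: "u \<in> C" for r u
  proof
    assume a: "is_pivot X f R r u"
    have "r \<noteq> s" using a Rsu u by (auto simp: is_pivot_def)
    moreover have "r \<noteq> t"
    proof
      assume "r = t"
      then obtain x where "x \<in> C" "f r < f x" "R x u \<noteq> 0"
        using a row_t [OF u] RC u by (auto simp: is_pivot_def)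
      then show False using a X_C(5) by (auto simp: is_pivot_def)
    qed
    ultimately have "r \<in> C" using a by (auto simp: is_pivot_def C_def)
    then show "is_pivot Y f R' r u"
      using a RC u X_C(5) by (auto simp: is_pivot_def cY)
  next
    assume a: "is_pivot Y f R' r u"
    then have r: "r \<in> C" "R' r u \<noteq> 0" "\<And>x. x \<in> C \<Longrightarrow> f r < f x \<Longrightarrow> R' x u = 0"
      by (auto simp: is_pivot_def cY)
    have "R x u = 0" if x: "x \<in> cells X" "f r < f x" for x
    proof -
      consider "x = s" | "x = t" | "x \<in> C" using x(1) X_C(1) by auto
      then show ?thesis
      proof cases
        case 2
        then show ?thesis using row_t [OF u] r(3) x by (metis order_less_trans)
      qed (use Rsu RC u r x in auto)
    qed
    then show "is_pivot X f R r u" using r RC u X_C by (auto simp: is_pivot_def)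
  qed
  have pivot_t: "is_pivot X f R r t \<longleftrightarrow> r = s" for r
  proof
    have s: "is_pivot X f R s t"
      using st by (auto simp: is_pivot_def Rt intro!: last_facet)
    then show "is_pivot X f R r t" if "r = s" using that by simp
    show "r = s" if "is_pivot X f R r t"
      using that s is_pivot_unique [OF fi(1,2)] by blast
  qed
  have pivot_s: "\<not> is_pivot X f R r s" for r
    using Rs by (auto simp: is_pivot_def)

  have "V x y - (if x = y then 1 else 0) = 0" if xy: "x \<in> cells X" "y \<in> cells X" "f y \<le> f x" for x y
  proof -
    have V'0: "V' x y = (if x = y then 1 else 0)" if "x \<in> C" "y \<in> C" "f y \<le> f x" for x y
      using V' that by (force simp: strictly_upper_def cY)
    consider "y = s" | "y = t" | "y \<in> C" using xy X_C(1) by auto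
    then show ?thesis
    proof cases
      case 1
      then show ?thesis using last_facet [of x] xy st by (auto simp: V_def c_def)
    next
      case 2
      then show ?thesis using \<open>s \<noteq> t\<close> by (simp add: V_def)
    next
      case 3
      have "inc X z s * V' z y = 0" if "z \<in> C" "x = t" for z
      proof (cases "inc X z s = 0")
        case False
        then have "f y < f z" using first_cofacet [of z] that xy by simp
        then show ?thesis using V'0 [of z y] that 3 by auto
      qed simp
      then have "(\<Sum>z\<in>C. inc X z s * V' z y) = 0" if "x = t"
        using that by (intro sum.neutral ballI)
      then show ?thesis using V'0 [of x y] 3 xy X_C by (auto simp: V_def)
    qed
  qed
  then have upper: "strictly_upper X f (\<lambda>x y. V x y - (if x = y then 1 else 0))"
    unfolding strictly_upper_def by blast
  have uniq: "u = u'" if "u \<in> cells X" "u' \<in> cells X" "is_pivot X f R r u" "is_pivot X f R r u'" for r u u'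
  proof -
    have in_C: "r \<in> C" if "u \<in> C" "is_pivot X f R r u" for r u
      using pivot_u that by (auto simp: is_pivot_def cY)
    have eq_C: "u = u'" if "u \<in> C" "u' \<in> C"
      using R' pivot_u that \<open>is_pivot X f R r u\<close> \<open>is_pivot X f R r u'\<close> cY
      unfolding reduced_form_def by blast
    have "u = t \<or> u \<in> C" "u' = t \<or> u' \<in> C"
      using that X_C(1) pivot_s by auto
    then show ?thesis using in_C eq_C that pivot_t X_C(2) by metis
  qed
  have "reduced_form X f R"
    unfolding reduced_form_def
    using upper uniq by (auto simp: R_def bd_matrix_def intro!: exI [of _ V])
  then have "BD X f = pivot_pairs X f R" by (rule BD_eq_pivot_pairs [OF fi(1,2)])
  also have "\<dots> = insert (s, t) (pivot_pairs Y f R')"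
    using X_C(1) cY pivot_s pivot_t pivot_u by (auto simp: pivot_pairs_def)
  also have "pivot_pairs Y f R' = BD Y f" by (rule BD_eq_pivot_pairs [OF fi(3,4) R', symmetric])
  finally show ?thesis by (simp add: Y_def)
qed


section \<open>Cancelling all shallow pairs\<close>

lemma BD_fold_cancel:
  assumes "lefschetz_complex X" "lefschetz_filter X f" "set vs \<subseteq> SH X f" "distinct vs"
  shows "BD X f = set vs \<union> BD (fold cancel vs X) f"
  using assms
proof (induction vs arbitrary: X)
  case (Cons p vs)
  have p: "p \<in> SH X f" using Cons.prems by simp
  note C = cancel_SH [OF Cons.prems(1,2) p]
  have "set vs \<subseteq> SH (cancel p X) f" using C(3) Cons.prems by auto
  then have "BD (cancel p X) f = set vs \<union> BD (fold cancel vs (cancel p X)) f"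
    using Cons.IH C Cons.prems by auto
  moreover have "BD X f = insert p (BD (cancel p X) f)"
    using BD_cancel [OF Cons.prems(1,2)] p by (cases p) auto
  ultimately show ?case by simp
qed simp

lemma cells_fold_cancel:
  "cells (fold cancel vs X) = cells X - (fst ` set vs \<union> snd ` set vs)"
  by (induction vs arbitrary: X) (auto simp: cancel_def split: prod.splits)

lemma finite_SH:
  assumes "lefschetz_complex X" shows "finite (SH X f)"
proof (rule finite_subset)
  show "SH X f \<subseteq> cells X \<times> cells X" by (auto simp: SH_def facet_def)
  show "finite (cells X \<times> cells X)" using assms by (simp add: lefschetz_complex_def)
qed

lemma quotient_SH:
  assumes X: "lefschetz_complex X" and f: "lefschetz_filter X f"
  shows "BD X f = SH X f \<union> BD (lefschetz_quotient X (SH X f)) f"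
    and "cells (lefschetz_quotient X (SH X f)) = cells X - (fst ` SH X f \<union> snd ` SH X f)"
proof -
  obtain vs where vs: "set vs = SH X f" "distinct vs"
    using finite_distinct_list [OF finite_SH [OF X]] by blast
  then have "lefschetz_quotient X (SH X f) = fold cancel vs X"
    using quotient_eq_fold [OF X f, of vs] by simp
  then show "BD X f = SH X f \<union> BD (lefschetz_quotient X (SH X f)) f"
    "cells (lefschetz_quotient X (SH X f)) = cells X - (fst ` SH X f \<union> snd ` SH X f)"
    using BD_fold_cancel [OF X f, of vs] vs by (simp_all add: cells_fold_cancel)
qed

text \<open>A facet pair with the smallest difference of filter values is shallow: a later facet of
  \<open>t\<close>, or an earlier cofacet of \<open>s\<close>, would give a smaller difference.\<close>

lemma SH_nonempty:
  assumes X: "lefschetz_complex X" and b: "\<not> boundaryless X"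
  shows "SH X f \<noteq> {}"
proof -
  let ?F = "{(x, y). facet X x y}" and ?d = "\<lambda>(x, y). f y - f x"
  have "?F \<subseteq> cells X \<times> cells X" by (auto simp: facet_def)
  then have "finite ?F"
    using X by (meson finite_SigmaI finite_subset lefschetz_complex_def)
  moreover have "?F \<noteq> {}" using b by (auto simp: boundaryless_def facet_def)
  ultimately obtain p where p: "p \<in> ?F" "\<And>q. q \<in> ?F \<Longrightarrow> ?d p \<le> ?d q"
    using arg_min_if_finite [of ?F ?d] by (metis linorder_not_le)
  obtain s t where st: "p = (s, t)" by (cases p)
  have min: "f t - f s \<le> f y - f x" if "facet X x y" for x y
    using p(2) [of "(x, y)"] that st by simp
  have "(s, t) \<in> SH X f"
    using p(1) min [of _ t] min [of s] by (intro SH_I) (force simp: st)+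
  then show ?thesis by blast
qed


section \<open>The sequence of quotients\<close>

lemma shallow_seq_filtered:
  assumes "lefschetz_complex X" "lefschetz_filter X f"
  shows "lefschetz_complex (shallow_seq X f i)" "lefschetz_filter (shallow_seq X f i) f"
  using assms by (induction i) (auto intro: quotient_filtered)

lemma BD_shallow_seq:
  assumes X: "lefschetz_complex X" "lefschetz_filter X f"
  shows "BD X f = (\<Union>i<m. SH (shallow_seq X f i) f) \<union> BD (shallow_seq X f m) f"
proof (induction m)
  case (Suc m)
  then show ?case
    using quotient_SH(1) [OF shallow_seq_filtered [OF X, of m]] by (simp add: lessThan_Suc Un_ac)
qed simp

lemma cells_shallow_seq_Suc:
  assumes X: "lefschetz_complex X" "lefschetz_filter X f"
  shows "cells (shallow_seq X f (Suc i)) = cells (shallow_seq X f i) -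
    (fst ` SH (shallow_seq X f i) f \<union> snd ` SH (shallow_seq X f i) f)"
  using quotient_SH(2) [OF shallow_seq_filtered [OF X]] by simp

lemma cells_shallow_seq_antimono:
  assumes X: "lefschetz_complex X" "lefschetz_filter X f" and "i \<le> j"
  shows "cells (shallow_seq X f j) \<subseteq> cells (shallow_seq X f i)"
proof (rule lift_Suc_antimono_le [OF _ \<open>i \<le> j\<close>])
  show "cells (shallow_seq X f (Suc n)) \<subseteq> cells (shallow_seq X f n)" for n
    unfolding cells_shallow_seq_Suc [OF X] by blast
qed

lemma SH_shallow_seq_disjoint:
  assumes X: "lefschetz_complex X" "lefschetz_filter X f" and "i < j"
  shows "SH (shallow_seq X f i) f \<inter> SH (shallow_seq X f j) f = {}"
proof -
  have "s \<in> cells (shallow_seq X f (Suc i))" if "(s, t) \<in> SH (shallow_seq X f j) f" for s t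
    using that cells_shallow_seq_antimono [OF X, of "Suc i" j] \<open>i < j\<close>
    by (auto simp: SH_def facet_def)
  then show ?thesis unfolding cells_shallow_seq_Suc [OF X] by force
qed

lemma ex_boundaryless_shallow_seq:
  assumes X: "lefschetz_complex X" "lefschetz_filter X f"
  shows "\<exists>m>0. boundaryless (shallow_seq X f m)"
proof (rule ccontr)
  assume a: "\<not> ?thesis"
  let ?n = "\<lambda>i. card (cells (shallow_seq X f (Suc i)))"
  have "?n (Suc i) < ?n i" for i
  proof -
    define Z where "Z = shallow_seq X f (Suc i)"
    have LZ: "lefschetz_complex Z"
      using shallow_seq_filtered [OF X, of "Suc i"] by (simp only: Z_def)
    have "\<not> boundaryless Z" using a unfolding Z_def by blast
    then obtain s t where "(s, t) \<in> SH Z f" using SH_nonempty [OF LZ] by fast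
    then have "s \<in> cells Z" "s \<in> fst ` SH Z f"
      using SH_D(1) [of s t Z f] by (auto simp: facet_def intro: rev_image_eqI)
    then have "cells (shallow_seq X f (Suc (Suc i))) \<subset> cells Z"
      unfolding cells_shallow_seq_Suc [OF X, of "Suc i"] Z_def by blast
    then show ?thesis
      using LZ unfolding Z_def [symmetric] by (intro psubset_card_mono) (auto simp: lefschetz_complex_def)
  qed
  then show False using wf_no_infinite_down_chainE [OF wf_less, of ?n] by blast
qed

theorem corollary6p6:
  fixes X :: "('a, 'k::field) lefschetz" and f :: "'a \<Rightarrow> real"
  assumes "lefschetz_complex X" and "lefschetz_filter X f"
  shows "\<exists>m>0. boundaryless (shallow_seq X f m) \<and>
           BD X f = (\<Union>i<m. SH (shallow_seq X f i) f) \<and>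
           disjoint_family_on (\<lambda>i. SH (shallow_seq X f i) f) {..<m}"
proof -
  obtain m where m: "m > 0" "boundaryless (shallow_seq X f m)"
    using ex_boundaryless_shallow_seq [OF assms] by blast
  then have "BD (shallow_seq X f m) f = {}"
    by (intro BD_eq_empty_if_boundaryless shallow_seq_filtered [OF assms])
  then have "BD X f = (\<Union>i<m. SH (shallow_seq X f i) f)"
    using BD_shallow_seq [OF assms, of m] by simp
  moreover have "disjoint_family_on (\<lambda>i. SH (shallow_seq X f i) f) {..<m}"
    unfolding disjoint_family_on_def
  proof (intro ballI impI)
    fix i j :: nat assume "i \<noteq> j"
    then show "SH (shallow_seq X f i) f \<inter> SH (shallow_seq X f j) f = {}"
      using SH_shallow_seq_disjoint [OF assms, of i j] SH_shallow_seq_disjoint [OF assms, of j i]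
      by (metis inf_commute linorder_neqE_nat)
  qed
  ultimately show ?thesis using m by blast
qed

end
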